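(* Let $n\ge1$ and $k\ge1$ be integers, let $\mathcal{M}^n_k$ be the multivariate B-spline kernel of order $k$ and $S^{\mathcal{M}^n_k}_w$ ($w>0$) the associated multivariate sampling Kantorovich operators with uniform sampling. (a) Let $f\in Lip_\infty(\nu)$ with $0<\nu\le1$. Then $\|S^{\mathcal{M}^n_k}_wf-f\|_\infty=\mathcal{O}(w^{-\nu})$ as $w\to+\infty$. Let moreover $\varphi$ be a convex $\varphi$-function. (b) For every $f\in L^\varphi(\mathbb{R}^n)$ there holds $$I^\varphi[\lambda S^{\mathcal{M}^n_k}_wf]\le\frac{1}{\delta^n}\,I^\varphi[\lambda f]$$ for some $\lambda>0$ and for every $w>0$, where $\delta=1$. In particular, $S^{\mathcal{M}^n_k}_wf\in L^\varphi(\mathbb{R}^n)$ whenever $f\in L^\varphi(\mathbb{R}^n)$. (c) For any $f\in L^\varphi(\mathbb{R}^n)\cap Lip_\varphi(\nu)$, $0<\nu\le1$, there exists $\lambda>0$ such that $I^\varphi[\lambda(S^{\mathcal{M}^n_k}_wf-f)]=\mathcal{O}(w^{-\nu})$ as $w\to+\infty$.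
   Context: **B-spline kernel.** The univariate central B-spline of order $k\in\mathbb{N}$, $k\ge1$, is $$M_k(x):=\frac{1}{(k-1)!}\sum_{i=0}^k(-1)^i\binom{k}{i}\left(\frac{k}{2}+x-i\right)_+^{k-1},\qquad x\in\mathbb{R},$$ where $(y)_+:=\max\{y,0\}$; for $k=1$ the symbol $(y)_+^0$ is read as $1$ if $y\ge0$ and $0$ if $y<0$. The multivariate B-spline kernel of order $k$ is $\mathcal{M}^n_k(\underline{x}):=\prod_{i=1}^nM_k(x_i)$, $\underline{x}=(x_1,\dots,x_n)\in\mathbb{R}^n$. **Operators.** For $w>0$ and $\underline{k}=(k_1,\dots,k_n)\in\mathbb{Z}^n$ (the multi-index $\underline{k}$ is unrelated to the order $k$) let $R^w_{\underline{k}}:=\prod_{i=1}^n[k_i/w,(k_i+1)/w]$ and $$(S^{\mathcal{M}^n_k}_wf)(\underline{x}):=\sum_{\underline{k}\in\mathbb{Z}^n}\left[w^n\int_{R^w_{\underline{k}}}f(\underline{u})\,d\underline{u}\right]\mathcal{M}^n_k(w\underline{x}-\underline{k}),\qquad\underline{x}\in\mathbb{R}^n,$$ for locally integrable $f:\mathbb{R}^n\to\mathbb{R}$ such that the series converges for every $\underline{x}$. The constant $\delta$ is the lower bound for the spacing of the sampling nodes $t_{\underline{k}}=\underline{k}$ in each coordinate. **Lipschitz class.** $C(\mathbb{R}^n)$ is the set of uniformly continuous and bounded functions $f:\mathbb{R}^n\to\mathbb{R}$ with the sup-norm $\|\cdot\|_\infty$; $\|\cdot\|_2$ is the Euclidean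 norm. For $0<\nu\le1$, $Lip_\infty(\nu)$ is the set of $f\in C(\mathbb{R}^n)$ for which there exist constants $C,\gamma>0$ such that $\|f(\cdot)-f(\cdot+\underline{t})\|_\infty\le C\|\underline{t}\|_2^\nu$ for all $\underline{t}\in\mathbb{R}^n$ with $\|\underline{t}\|_2\le\gamma$. **Orlicz spaces.** A $\varphi$-function is a function $\varphi:[0,+\infty)\to[0,+\infty)$ that is non-decreasing and continuous, with $\varphi(0)=0$, $\varphi(u)>0$ for $u>0$, and $\lim_{u\to+\infty}\varphi(u)=+\infty$. For $f\in M(\mathbb{R}^n)$ (the Lebesgue measurable functions $f:\mathbb{R}^n\to\mathbb{R}$), $I^\varphi[f]:=\int_{\mathbb{R}^n}\varphi(|f(\underline{x})|)\,d\underline{x}$. The Orlicz space is $L^\varphi(\mathbb{R}^n):=\{f\in M(\mathbb{R}^n): I^\varphi[\lambda f]<+\infty\text{ for some }\lambda>0\}$. For $0<\nu\le1$, $Lip_\varphi(\nu)$ is the set of $f\in M(\mathbb{R}^n)$ for which there exists $\lambda>0$ with $I^\varphi[\lambda(f(\cdot)-f(\cdot+\underline{t}))]=\mathcal{O}(\|\underline{t}\|_2^\nu)$ as $\|\underline{t}\|_2\to0$, i.e. there are $C,\bar\gamma>0$ such that the left side is $\le C\|\underline{t}\|_2^\nu$ whenever $\|\underline{t}\|_2\le\bar\gamma$. *)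

theory Defs
  imports "HOL-Analysis.Analysis"
begin

text \<open>The space \<open>\<real>\<^sup>n\<close> is \<open>real ^ 'n\<close> with \<open>n = CARD('n)\<close>, and \<open>\<int>\<^sup>n\<close> is \<open>int ^ 'n\<close>.\<close>

text \<open>The truncated power \<open>(y)\<^sub>+\<close> to the \<open>m\<close>. The case \<open>m = 0\<close> is separate because
  \<open>max y 0 ^ 0 = 1\<close> also for negative \<open>y\<close>.\<close>

definition trunc_pow :: "real \<Rightarrow> nat \<Rightarrow> real" where
  "trunc_pow y m = (if m = 0 then (if y \<ge> 0 then 1 else 0) else (max y 0) ^ m)"

definition central_bspline :: "nat \<Rightarrow> real \<Rightarrow> real" where
  "central_bspline k x =
     1 / fact (k - 1) *
       (\<Sum>i = 0..k. (- 1) ^ i * real (k choose i) * trunc_pow (real k / 2 + x - real i) (k - 1))"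

definition bspline_kernel :: "nat \<Rightarrow> real ^ 'n \<Rightarrow> real" where
  "bspline_kernel k x = (\<Prod>i\<in>UNIV. central_bspline k (x $ i))"

definition int_node :: "int ^ 'n \<Rightarrow> real ^ 'n" where
  "int_node j = (\<chi> i. real_of_int (j $ i))"

definition sample_box :: "real \<Rightarrow> int ^ 'n \<Rightarrow> (real ^ 'n) set" where
  "sample_box w j = cbox (\<chi> i. real_of_int (j $ i) / w) (\<chi> i. (real_of_int (j $ i) + 1) / w)"

definition kantorovich_term ::
    "(real ^ 'n \<Rightarrow> real) \<Rightarrow> real \<Rightarrow> (real ^ 'n \<Rightarrow> real) \<Rightarrow> real ^ 'n \<Rightarrow> int ^ 'n \<Rightarrow> real" where
  "kantorovich_term \<kappa> w f x j =
     (w ^ CARD('n) * (LINT u:sample_box w j|lebesgue. f u)) * \<kappa> (w *\<^sub>R x - int_node j)"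

definition kantorovich ::
    "(real ^ 'n \<Rightarrow> real) \<Rightarrow> real \<Rightarrow> (real ^ 'n \<Rightarrow> real) \<Rightarrow> real ^ 'n \<Rightarrow> real" where
  "kantorovich \<kappa> w f x = (\<Sum>\<^sub>\<infinity>j\<in>UNIV. kantorovich_term \<kappa> w f x j)"

definition locally_integrable :: "(real ^ 'n \<Rightarrow> real) \<Rightarrow> bool" where
  "locally_integrable f \<longleftrightarrow> (\<forall>K. compact K \<longrightarrow> set_integrable lebesgue K f)"

text \<open>The domain of the operator: outside it, the totalised integral and infinite sum in
  \<open>kantorovich\<close> return the meaningless value \<open>0\<close>.\<close>

definition kantorovich_defined ::
    "(real ^ 'n \<Rightarrow> real) \<Rightarrow> real \<Rightarrow> (real ^ 'n \<Rightarrow> real) \<Rightarrow> bool" where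
  "kantorovich_defined \<kappa> w f \<longleftrightarrow>
     locally_integrable f \<and> (\<forall>x. kantorovich_term \<kappa> w f x summable_on UNIV)"

text \<open>Extended-valued, so that a bound by a finite number includes boundedness.\<close>

definition sup_norm :: "(real ^ 'n \<Rightarrow> real) \<Rightarrow> ennreal" where
  "sup_norm g = (SUP x. ennreal \<bar>g x\<bar>)"

definition Lip_infty :: "real \<Rightarrow> (real ^ 'n \<Rightarrow> real) set" where
  "Lip_infty \<nu> = {f. uniformly_continuous_on UNIV f \<and> bounded (range f) \<and>
     (\<exists>C>0. \<exists>\<gamma>>0. \<forall>t. norm t \<le> \<gamma> \<longrightarrow>
        sup_norm (\<lambda>x. f x - f (x + t)) \<le> ennreal (C * norm t powr \<nu>))}"

text \<open>A function on \<open>[0,\<infinity>)\<close> is a total function whose values at negative arguments are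
  unconstrained and never used.\<close>

definition phi_function :: "(real \<Rightarrow> real) \<Rightarrow> bool" where
  "phi_function \<phi> \<longleftrightarrow>
     mono_on {0..} \<phi> \<and> continuous_on {0..} \<phi> \<and> \<phi> 0 = 0 \<and> (\<forall>u>0. \<phi> u > 0) \<and>
     filterlim \<phi> at_top at_top"

definition modular :: "(real \<Rightarrow> real) \<Rightarrow> (real ^ 'n \<Rightarrow> real) \<Rightarrow> ennreal" where
  "modular \<phi> f = (\<integral>\<^sup>+ x. ennreal (\<phi> \<bar>f x\<bar>) \<partial>lebesgue)"

definition Orlicz :: "(real \<Rightarrow> real) \<Rightarrow> (real ^ 'n \<Rightarrow> real) set" where
  "Orlicz \<phi> = {f \<in> borel_measurable lebesgue. \<exists>l>0. modular \<phi> (\<lambda>x. l * f x) < \<infinity>}"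

definition Lip_phi :: "(real \<Rightarrow> real) \<Rightarrow> real \<Rightarrow> (real ^ 'n \<Rightarrow> real) set" where
  "Lip_phi \<phi> \<nu> = {f \<in> borel_measurable lebesgue.
     \<exists>l>0. \<exists>C>0. \<exists>\<gamma>>0. \<forall>t. norm t \<le> \<gamma> \<longrightarrow>
       modular \<phi> (\<lambda>x. l * (f x - f (x + t))) \<le> ennreal (C * norm t powr \<nu>)}"

end

theory Submission
  imports Defs "HOL-Probability.Probability_Measure"
begin

text \<open>
  The operator is an integral operator \<open>S\<^sub>w f x = \<integral> K x u * f u du\<close> with kernel
  \<open>K x u = w\<^sup>n * M (w x - \<lfloor>w u\<rfloor>)\<close>. This kernel is nonnegative and bounded by a multiple of \<open>w\<^sup>n\<close>,
  it vanishes when \<open>\<parallel>u - x\<parallel>\<close> exceeds a multiple of \<open>1 / w\<close>, and both of its marginal integrals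
  are \<open>1\<close>: for fixed \<open>x\<close> this is the partition of unity of the B-spline, for fixed \<open>u\<close> it is the
  normalisation \<open>\<integral> M = 1\<close>. So \<open>S\<^sub>w f x\<close> is a mean of \<open>f\<close> near \<open>x\<close>, which gives the Lipschitz
  estimate in the sup norm, and Jensen's inequality for \<open>K x u du\<close> followed by Tonelli gives the
  modular inequality. For the modular error, Jensen bounds \<open>\<phi> (l \<bar>S\<^sub>w f x - f x\<bar>)\<close> by
  \<open>\<integral> K x u * \<phi> (l \<bar>f u - f x\<bar>) du\<close>; substituting \<open>u = x + t\<close> and integrating over \<open>x\<close> first
  leaves an average of the modulars of \<open>f - f(\<cdot> + t)\<close> over a ball of radius \<open>O(1 / w)\<close>, whose
  volume absorbs the factor \<open>w\<^sup>n\<close>.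
\<close>

subsection \<open>Univariate B-splines\<close>

text \<open>The B-spline of order \<open>m + 1\<close>, shifted so that its support is \<open>[0, m + 1]\<close>.\<close>

definition cardinal_bspline :: "nat \<Rightarrow> real \<Rightarrow> real" where
  "cardinal_bspline m y =
     (\<Sum>i\<le>Suc m. (-1) ^ i * real (Suc m choose i) * trunc_pow (y - real i) m) / fact m"

lemma central_bspline_Suc:
  "central_bspline (Suc m) x = cardinal_bspline m (x + real (Suc m) / 2)"
  by (simp add: central_bspline_def cardinal_bspline_def atMost_atLeast0 field_simps)

text \<open>The convention at exponent \<open>0\<close> makes this true for \<open>m = 0\<close> as
  well, so the recurrence below can start from the indicator function.\<close>

lemma trunc_pow_Suc: "trunc_pow y (Suc m) = y * trunc_pow y m"
  by (auto simp: trunc_pow_def max_def)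

lemma trunc_pow_measurable [measurable]: "(\<lambda>y. trunc_pow y m) \<in> borel_measurable borel"
  unfolding trunc_pow_def by (cases "m = 0") simp_all

lemma cardinal_bspline_measurable [measurable]: "cardinal_bspline m \<in> borel_measurable borel"
proof -
  have "cardinal_bspline m = (\<lambda>y. (\<Sum>i\<le>Suc m. (-1) ^ i * real (Suc m choose i) * trunc_pow (y - real i) m) / fact m)"
    by (auto simp: cardinal_bspline_def)
  also have "\<dots> \<in> borel_measurable borel"
    by measurable
  finally show ?thesis .
qed

lemma cardinal_bspline_0: "cardinal_bspline 0 y = indicator {0..<1} y"
  by (auto simp: cardinal_bspline_def trunc_pow_def indicator_def)

lemma has_bochner_integral_indicator_1:
  fixes A :: "real set"
  assumes "A \<in> sets lborel" "emeasure lborel A = 1"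
  shows "has_bochner_integral lborel (indicator A) (1 :: real)"
  using has_bochner_integral_real_indicator[of A lborel] assms by (simp add: measure_def)

text \<open>Cox-de Boor recurrence for integer knots. Since \<open>y - real i\<close> raises the
  exponent of \<open>trunc_pow (y - real i) m\<close> by one, it suffices to match the coefficients
  of each truncated power.\<close>

lemma cardinal_bspline_rec:
  "real (Suc m) * cardinal_bspline (Suc m) y =
     y * cardinal_bspline m y + (real m + 2 - y) * cardinal_bspline m (y - 1)"
proof -
  define a where "a i = trunc_pow (y - real i) m" for i
  \<comment> \<open>\<open>c i\<close> is the binomial coefficient with lower index
    \<open>i - 1\<close>, read as \<open>0\<close> at \<open>i = 0\<close>. Pascal's rule
    (\<open>1\<close>) and the absorption identity (\<open>2\<close>) then hold for all
    \<open>i\<close>.\<close>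
  define c where "c i = (case i of 0 \<Rightarrow> 0 | Suc l \<Rightarrow> real (Suc m choose l))" for i
  have 1: "real (Suc (Suc m) choose i) = real (Suc m choose i) + c i" for i
    by (cases i) (simp_all add: c_def)
  have 2: "real i * real (Suc (Suc m) choose i) = (real m + 2) * c i" for i
  proof (cases i)
    case (Suc l)
    have "real (Suc l * (Suc (Suc m) choose Suc l)) = real (Suc (Suc m) * (Suc m choose l))"
      by (simp only: Suc_times_binomial)
    then show ?thesis using Suc by (simp add: c_def algebra_simps del: binomial_Suc_Suc)
  qed (simp add: c_def)
  have coeff: "real (Suc (Suc m) choose i) * (y - real i)
      = real (Suc m choose i) * y - c i * (real m + 2 - y)" for i
    using 1[of i] 2[of i] by (simp add: algebra_simps del: binomial_Suc_Suc)
  have scaled: "fact m * cardinal_bspline m z = (\<Sum>i\<le>Suc m. (-1) ^ i * real (Suc m choose i) * trunc_pow (z - real i) m)" for z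
    by (simp add: cardinal_bspline_def)
  have "fact m * (y * cardinal_bspline m y) = y * (fact m * cardinal_bspline m y)"
    by simp
  \<comment> \<open>The new last term has binomial coefficient \<open>0\<close>; it is added so that
    both sums have the same range.\<close>
  also have "\<dots> = (\<Sum>i\<le>Suc (Suc m). (-1)^i * (real (Suc m choose i) * y) * a i)"
    unfolding scaled sum.atMost_Suc[of _ "Suc m"]
    by (simp add: a_def sum_distrib_left mult_ac binomial_eq_0 del: binomial_Suc_Suc sum.atMost_Suc)
  finally have first: "fact m * (y * cardinal_bspline m y)
      = (\<Sum>i\<le>Suc (Suc m). (-1)^i * (real (Suc m choose i) * y) * a i)" .
  have "fact m * cardinal_bspline m (y - 1)
      = (\<Sum>i\<le>Suc m. (-1)^i * real (Suc m choose i) * a (Suc i))"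
    unfolding scaled by (simp add: a_def algebra_simps del: binomial_Suc_Suc sum.atMost_Suc)
  \<comment> \<open>Index shift by one: the sign flips, and the new term at \<open>0\<close>
    vanishes because \<open>c 0 = 0\<close>.\<close>
  also have "\<dots> = (\<Sum>i\<le>Suc (Suc m). - ((-1)^i * c i * a i))"
    by (subst (2) sum.atMost_Suc_shift) (simp add: c_def del: binomial_Suc_Suc sum.atMost_Suc)
  finally have "(real m + 2 - y) * (fact m * cardinal_bspline m (y - 1))
      = (real m + 2 - y) * (\<Sum>i\<le>Suc (Suc m). - ((-1)^i * c i * a i))"
    by (rule arg_cong)
  then have "fact m * ((real m + 2 - y) * cardinal_bspline m (y - 1))
      = (\<Sum>i\<le>Suc (Suc m). - ((-1)^i * (c i * (real m + 2 - y)) * a i))"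
    by (simp add: sum_distrib_left mult_ac del: binomial_Suc_Suc sum.atMost_Suc)
  with first have "fact m * (y * cardinal_bspline m y + (real m + 2 - y) * cardinal_bspline m (y - 1))
      = (\<Sum>i\<le>Suc (Suc m). (-1)^i * (real (Suc m choose i) * y - c i * (real m + 2 - y)) * a i)"
    by (simp add: sum.distrib[symmetric] algebra_simps del: binomial_Suc_Suc sum.atMost_Suc)
  also have "\<dots> = (\<Sum>i\<le>Suc (Suc m). (-1)^i * real (Suc (Suc m) choose i) * trunc_pow (y - real i) (Suc m))"
    unfolding coeff[symmetric] trunc_pow_Suc a_def by (simp only: mult_ac)
  also have "\<dots> = fact (Suc m) * cardinal_bspline (Suc m) y"
    by (simp add: cardinal_bspline_def del: binomial_Suc_Suc sum.atMost_Suc)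
  finally have "fact m * (y * cardinal_bspline m y + (real m + 2 - y) * cardinal_bspline m (y - 1))
     = fact m * (real (Suc m) * cardinal_bspline (Suc m) y)"
    by (simp add: mult_ac)
  then show ?thesis by simp
qed

text \<open>To the right of the support all truncated powers are active and must cancel. The
  recurrence avoids this computation: outside the larger interval both \<open>y\<close> and
  \<open>y - 1\<close> lie outside the smaller one.\<close>

lemma cardinal_bspline_support:
  assumes "y \<notin> {0..real (Suc m)}"
  shows "cardinal_bspline m y = 0"
  using assms
proof (induction m arbitrary: y)
  case (Suc m)
  have "cardinal_bspline m y = 0" "cardinal_bspline m (y - 1) = 0"
    using Suc.prems by (auto intro!: Suc.IH)
  then show ?case using cardinal_bspline_rec[of m y] by simp
qed (auto simp: cardinal_bspline_0)

text \<open>Each linear factor of the recurrence is negative only where the spline it multiplies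
  vanishes.\<close>

lemma cardinal_bspline_nonneg: "0 \<le> cardinal_bspline m y"
proof (induction m arbitrary: y)
  case (Suc m)
  have "0 \<le> y * cardinal_bspline m y"
    using Suc[of y] cardinal_bspline_support[of y m] by (cases "0 \<le> y") auto
  moreover have "0 \<le> (real m + 2 - y) * cardinal_bspline m (y - 1)"
    using Suc[of "y - 1"] cardinal_bspline_support[of "y - 1" m] by (cases "y \<le> real m + 2") auto
  ultimately have "0 \<le> real (Suc m) * cardinal_bspline (Suc m) y"
    using cardinal_bspline_rec[of m y] by linarith
  then show ?case by (simp add: zero_le_mult_iff)
qed (simp add: cardinal_bspline_0)

lemma cardinal_bspline_bounded: "\<exists>B>0. \<forall>y. cardinal_bspline m y \<le> B"
proof (induction m)
  case 0
  then show ?case by (intro exI[of _ 1]) (simp add: cardinal_bspline_0 indicator_def)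
next
  case (Suc m)
  then obtain B where B: "B > 0" "\<And>y. cardinal_bspline m y \<le> B" by blast
  \<comment> \<open>On the support both linear factors of the recurrence lie between
    \<open>0\<close> and \<open>m + 2\<close>; the factor \<open>Suc m\<close> on its left side is
    at least \<open>1\<close> and is dropped.\<close>
  have "cardinal_bspline (Suc m) y \<le> 2 * (real m + 2) * B" for y
  proof (cases "y \<in> {0..real m + 2}")
    case True
    have "cardinal_bspline (Suc m) y \<le> real (Suc m) * cardinal_bspline (Suc m) y"
      using cardinal_bspline_nonneg[of "Suc m" y] mult_right_mono[of 1 "real (Suc m)"] by fastforce
    also have "\<dots> \<le> (real m + 2) * B + (real m + 2) * B"
      unfolding cardinal_bspline_rec using True B
      by (intro add_mono mult_mono) (auto simp: cardinal_bspline_nonneg)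
    finally show ?thesis by (simp add: algebra_simps)
  next
    case False
    then have "cardinal_bspline (Suc m) y = 0"
      by (intro cardinal_bspline_support) auto
    then show ?thesis using B by simp
  qed
  then show ?case using B by (intro exI[of _ "2 * (real m + 2) * B"]) auto
qed

text \<open>Both marginals come from this lemma: \<open>h s = s\<close> gives the normalisation and
  \<open>h s = y - \<lfloor>-s\<rfloor>\<close> the partition of unity. By the recurrence, raising the order changes the
  integrand only by a difference \<open>c (h s - 1) - c (h s)\<close>, which integrates to \<open>0\<close>.\<close>

lemma has_bochner_integral_cardinal_bspline:
  fixes h :: "real \<Rightarrow> real"
  assumes h [measurable]: "h \<in> borel_measurable borel"
    and shift: "\<And>s. h (s - 1) = h s - 1"
    and base: "has_bochner_integral lborel (\<lambda>s. cardinal_bspline 0 (h s)) 1"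
  shows "has_bochner_integral lborel (\<lambda>s. cardinal_bspline m (h s)) 1"
proof (induction m)
  case (Suc m)
  define c where "c z = (real m + 1 - z) * cardinal_bspline m z" for z
  have [measurable]: "c \<in> borel_measurable borel"
    unfolding c_def by measurable
  \<comment> \<open>Where the spline is nonzero, \<open>m + 1 - z\<close> lies between
    \<open>0\<close> and \<open>m + 1\<close>, so \<open>c\<close> inherits integrability from the
    induction hypothesis.\<close>
  have cb: "\<bar>c z\<bar> \<le> (real m + 1) * cardinal_bspline m z" for z
  proof (cases "z \<in> {0..real (Suc m)}")
    case True
    then show ?thesis
      using cardinal_bspline_nonneg[of m z] by (auto simp: c_def abs_mult intro!: mult_right_mono)
  next
    case False
    then show ?thesis
      using cardinal_bspline_support[OF False] by (simp add: c_def)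
  qed
  have "integrable lborel (\<lambda>s. (real m + 1) * cardinal_bspline m (h s))"
    using Suc by (simp add: has_bochner_integral_iff)
  then have "integrable lborel (\<lambda>s. c (h s))"
    by (rule Bochner_Integration.integrable_bound) (auto intro!: AE_I2 order_trans[OF cb abs_ge_self])
  then obtain I where I: "has_bochner_integral lborel (\<lambda>s. c (h s)) I"
    by (auto simp: integrable.simps)
  \<comment> \<open>Translation invariance, in the form of an affine substitution with slope
    \<open>1\<close>; \<open>shift\<close> turns \<open>h (s - 1)\<close> into
    \<open>h s - 1\<close>.\<close>
  have "has_bochner_integral lborel (\<lambda>s. c (h (-1 + 1 * s))) (I /\<^sub>R \<bar>1\<bar>)"
    using I by (subst lborel_has_bochner_integral_real_affine_iff[symmetric]) simp_all
  then have I': "has_bochner_integral lborel (\<lambda>s. c (h s - 1)) I"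
    by (simp add: shift[symmetric])
  have step: "cardinal_bspline (Suc m) z = cardinal_bspline m z + (c (z - 1) - c z) / real (Suc m)" for z
    using cardinal_bspline_rec[of m z] by (simp add: c_def field_simps)
  have "has_bochner_integral lborel
     (\<lambda>s. cardinal_bspline m (h s) + (c (h s - 1) - c (h s)) / real (Suc m)) (1 + (I - I) / real (Suc m))"
    by (intro has_bochner_integral_add has_bochner_integral_divide_zero has_bochner_integral_diff Suc I I')
  then show ?case by (simp add: step)
qed (rule base)

section \<open>Centred B-splines: support, bound and the two integral identities\<close>

lemma central_bspline_measurable [measurable]: "central_bspline k \<in> borel_measurable borel"
proof -
  have "central_bspline k = (\<lambda>x. 1 / fact (k - 1) *
     (\<Sum>i = 0..k. (- 1) ^ i * real (k choose i) * trunc_pow (real k / 2 + x - real i) (k - 1)))"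
    by (auto simp: central_bspline_def)
  also have "\<dots> \<in> borel_measurable borel"
    by measurable
  finally show ?thesis .
qed

context
  fixes k :: nat
  assumes k: "k \<ge> 1"
begin

lemma central_bspline_eq: "central_bspline k x = cardinal_bspline (k - 1) (x + real k / 2)"
  using central_bspline_Suc[of "k - 1" x] k by simp

lemma central_bspline_nonneg: "0 \<le> central_bspline k x"
  by (simp add: central_bspline_eq cardinal_bspline_nonneg)

lemma central_bspline_support: "\<bar>x\<bar> > real k / 2 \<Longrightarrow> central_bspline k x = 0"
  using k by (auto simp: central_bspline_eq intro!: cardinal_bspline_support)

lemma central_bspline_bounded: "\<exists>B>0. \<forall>x. central_bspline k x \<le> B"
  using cardinal_bspline_bounded[of "k - 1"] by (auto simp: central_bspline_eq)

text \<open>The normalisation, with \<open>h\<close> a translation; the factor \<open>w\<close>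
  comes from the substitution of \<open>w * s\<close> for \<open>s\<close>.\<close>

lemma nn_integral_central_bspline_translate:
  assumes "w > 0"
  shows "(\<integral>\<^sup>+ s. w * central_bspline k (w * s - a) \<partial>lborel) = 1"
proof -
  have ind: "indicator {0..<1} (s + b) = (indicator {-b..<1-b} s :: real)" for s b :: real
    by (auto simp: indicator_def)
  have "has_bochner_integral lborel (\<lambda>s. cardinal_bspline (k - 1) (s + (real k / 2 - a))) 1"
  proof (rule has_bochner_integral_cardinal_bspline)
    show "has_bochner_integral lborel (\<lambda>s. cardinal_bspline 0 (s + (real k / 2 - a))) 1"
      unfolding cardinal_bspline_0 ind
      by (rule has_bochner_integral_indicator_1) auto
  qed auto
  then have "has_bochner_integral lborel (\<lambda>s. central_bspline k (s - a)) 1"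
    by (simp add: central_bspline_eq algebra_simps)
  then have "(\<integral>\<^sup>+ s. central_bspline k (s - a) \<partial>lborel) = 1"
    using nn_integral_eq_integral[of lborel "\<lambda>s. central_bspline k (s - a)"]
    by (simp add: has_bochner_integral_iff central_bspline_nonneg)
  then show ?thesis
    using nn_integral_real_affine[of "\<lambda>s. ennreal (central_bspline k (s - a))" w 0] assms
    by (simp add: ennreal_mult central_bspline_nonneg nn_integral_cmult)
qed

text \<open>The partition of unity as an integral: the integrand is a step function on cells of
  length \<open>1 / w\<close>, so the integral is the sum of
  \<open>central_bspline k (y - j)\<close> over the integers \<open>j\<close>.\<close>

lemma nn_integral_central_bspline_floor:
  assumes "w > 0"
  shows "(\<integral>\<^sup>+ s. w * central_bspline k (y - of_int \<lfloor>w * s\<rfloor>) \<partial>lborel) = 1"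
proof -
  define z where "z = y + real k / 2"
  have ind: "indicator {0..<1} (z - of_int \<lfloor>-s\<rfloor>)
      = (indicator {- of_int \<lfloor>z\<rfloor> - 1 <.. - of_int \<lfloor>z\<rfloor>} s :: real)" for s :: real
  proof -
    have "(z - of_int \<lfloor>-s\<rfloor> \<in> {0..<1}) \<longleftrightarrow> \<lfloor>z\<rfloor> = \<lfloor>-s\<rfloor>"
      using floor_correct[of z] by (auto simp: floor_eq_iff)
    also have "\<dots> \<longleftrightarrow> \<lfloor>-s\<rfloor> = \<lfloor>z\<rfloor>"
      by auto
    also have "\<dots> \<longleftrightarrow> s \<in> {- of_int \<lfloor>z\<rfloor> - 1 <.. - of_int \<lfloor>z\<rfloor>}"
      unfolding floor_eq_iff by auto
    finally show ?thesis by (auto simp: indicator_def)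
  qed
  \<comment> \<open>The reflection \<open>-s\<close> gives \<open>h\<close> the required sign:
    \<open>h (s - 1) = h s - 1\<close>, whereas the floor of \<open>s\<close> itself would give
    \<open>h s + 1\<close>. The slope \<open>-w\<close> in the last substitution undoes it.\<close>
  have "has_bochner_integral lborel (\<lambda>s::real. cardinal_bspline (k - 1) (z - of_int \<lfloor>-s\<rfloor>)) 1"
  proof (rule has_bochner_integral_cardinal_bspline[where h = "\<lambda>s::real. z - of_int \<lfloor>-s\<rfloor>"])
    show "has_bochner_integral lborel (\<lambda>s::real. cardinal_bspline 0 (z - of_int \<lfloor>-s\<rfloor>)) 1"
      unfolding cardinal_bspline_0 ind
      by (rule has_bochner_integral_indicator_1) auto
    show "z - of_int \<lfloor>-(s - 1)\<rfloor> = z - of_int \<lfloor>-s\<rfloor> - 1" for s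
      using floor_add_int[of "-s" 1] by simp
  qed simp
  then have "has_bochner_integral lborel (\<lambda>s::real. central_bspline k (y - of_int \<lfloor>-s\<rfloor>)) 1"
    by (simp add: central_bspline_eq z_def algebra_simps)
  then have "(\<integral>\<^sup>+ s. central_bspline k (y - of_int \<lfloor>-s :: real\<rfloor>) \<partial>lborel) = 1"
    using nn_integral_eq_integral[of lborel "\<lambda>s::real. central_bspline k (y - of_int \<lfloor>-s\<rfloor>)"]
    by (simp add: has_bochner_integral_iff central_bspline_nonneg)
  then show ?thesis
    using nn_integral_real_affine[of "\<lambda>s::real. ennreal (central_bspline k (y - of_int \<lfloor>-s\<rfloor>))" "-w" 0] assms
    by (simp add: ennreal_mult central_bspline_nonneg nn_integral_cmult)
qed

end


subsection \<open>Averaging kernels\<close>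

lemma nn_integral_lborel_translate:
  fixes a :: "'a::euclidean_space"
  assumes [measurable]: "f \<in> borel_measurable borel"
  shows "(\<integral>\<^sup>+ x. f (a + x) \<partial>lborel) = (\<integral>\<^sup>+ x. f x \<partial>lborel)"
proof -
  have "(\<integral>\<^sup>+ x. f x \<partial>lborel) = (\<integral>\<^sup>+ x. f x \<partial>distr lborel borel ((+) a))"
    by (simp add: lborel_distr_plus)
  also have "\<dots> = (\<integral>\<^sup>+ x. f (a + x) \<partial>lborel)"
    by (rule nn_integral_distr) auto
  finally show ?thesis ..
qed

text \<open>The continuous counterpart of a doubly stochastic band matrix with entries at most
  \<open>B\<close> and band of half-width \<open>r\<close>. The estimates below use only these
  properties.\<close>

locale averaging_kernel =
  fixes K :: "'a::euclidean_space \<Rightarrow> 'a \<Rightarrow> real" and r B :: real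
  assumes measurable_K [measurable]: "case_prod K \<in> borel_measurable (borel \<Otimes>\<^sub>M borel)"
    and K_nonneg: "0 \<le> K x u"
    and K_le: "K x u \<le> B"
    and K_support: "norm (u - x) > r \<Longrightarrow> K x u = 0"
    and nn_integral_K_right: "(\<integral>\<^sup>+ u. K x u \<partial>lborel) = 1"
    and nn_integral_K_left: "(\<integral>\<^sup>+ x. K x u \<partial>lborel) = 1"
begin

definition average :: "('a \<Rightarrow> real) \<Rightarrow> 'a \<Rightarrow> real" where
  "average g x = (LINT u|lborel. K x u * g u)"

text \<open>Balls of radius \<open>r\<close> suffice because \<open>K x\<close> vanishes outside
  \<open>cball x r\<close>.\<close>

definition local_L1 :: "('a \<Rightarrow> real) \<Rightarrow> bool" where
  "local_L1 g \<longleftrightarrow> g \<in> borel_measurable borel \<and> (\<forall>x. set_integrable lborel (cball x r) g)"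

lemma measurable_local_L1: "local_L1 g \<Longrightarrow> g \<in> borel_measurable borel"
  by (simp add: local_L1_def)

lemma B_nonneg: "0 \<le> B"
  using K_nonneg K_le by (rule order_trans)

lemma prob_space_K: "prob_space (density lborel (K x))"
  by (rule prob_spaceI) (simp add: emeasure_density nn_integral_K_right)

lemma integral_K_right: "has_bochner_integral lborel (K x) 1"
  by (rule has_bochner_integral_nn_integral) (simp_all add: nn_integral_K_right K_nonneg)

lemma integrable_K_mult:
  assumes "local_L1 g"
  shows "integrable lborel (\<lambda>u. K x u * g u)"
proof -
  have [measurable]: "g \<in> borel_measurable borel"
    using assms by (rule measurable_local_L1)
  have bound: "norm (K x u * g u) \<le> norm (B * (indicator (cball x r) u *\<^sub>R g u))" for u
  proof (cases "u \<in> cball x r")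
    case True
    then show ?thesis
      using K_nonneg K_le B_nonneg by (auto simp: abs_mult intro!: mult_right_mono)
  next
    case False
    then show ?thesis
      using K_support[of u x] by (simp add: dist_norm norm_minus_commute)
  qed
  show ?thesis
  proof (rule Bochner_Integration.integrable_bound)
    show "integrable lborel (\<lambda>u. B * (indicator (cball x r) u *\<^sub>R g u))"
      using assms by (simp add: local_L1_def set_integrable_def)
  qed (use bound in auto)
qed

lemma local_L1_diff_const:
  assumes "local_L1 g"
  shows "local_L1 (\<lambda>u. g u - c)"
proof -
  have "set_integrable lborel (cball x r) (\<lambda>u. c)" for x :: 'a
    using emeasure_bounded_finite[OF bounded_cball, of x r] by (simp add: set_integrable_def)
  then show ?thesis
    using assms by (auto simp: local_L1_def intro!: set_integral_diff)
qed

lemma borel_measurable_average: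
  assumes [measurable]: "g \<in> borel_measurable borel"
  shows "average g \<in> borel_measurable borel"
  unfolding average_def by measurable

text \<open>\<open>K x\<close> has mass \<open>1\<close>, so constants are reproduced and the error
  is itself an average, to which Jensen's inequality applies.\<close>

lemma average_diff:
  assumes "local_L1 g"
  shows "average g x - c = average (\<lambda>u. g u - c) x"
  using integrable_K_mult[OF assms, of x] integral_K_right[of x]
  by (simp add: average_def right_diff_distrib has_bochner_integral_iff)

text \<open>Jensen's inequality for the probability measure with density \<open>K x\<close>. An
  infinite right side is trivial; a finite one provides the integrability that Jensen's inequality
  requires.\<close>

lemma average_jensen:
  assumes g: "local_L1 g"
    and q: "convex_on UNIV q" "q \<in> borel_measurable borel" "\<And>y. 0 \<le> q y"
  shows "ennreal (q (average g x)) \<le> (\<integral>\<^sup>+ u. K x u * q (g u) \<partial>lborel)"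
proof (cases "(\<integral>\<^sup>+ u. K x u * q (g u) \<partial>lborel) = \<infinity>")
  case False
  note [measurable] = q(2) measurable_local_L1[OF g]
  interpret prob_space "density lborel (K x)"
    by (rule prob_space_K)
  have int: "integrable lborel (\<lambda>u. K x u * q (g u))"
    using False by (simp add: integrable_iff_bounded abs_mult K_nonneg q(3) top.not_eq_extremum)
  have "q (expectation g) \<le> expectation (\<lambda>u. q (g u))"
    by (rule jensens_inequality[where I = UNIV])
       (use int integrable_K_mult[OF g] q(1) in \<open>simp_all add: integrable_density K_nonneg\<close>)
  then have "q (average g x) \<le> (LINT u|lborel. K x u * q (g u))"
    by (simp add: integral_density K_nonneg average_def)
  then show ?thesis
    using int by (simp add: nn_integral_eq_integral K_nonneg q(3) ennreal_leI)
qed simp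

lemma abs_average_diff_le:
  assumes g: "local_L1 g"
    and D: "\<And>u. norm (u - x) \<le> r \<Longrightarrow> \<bar>g u - g x\<bar> \<le> D"
  shows "ennreal \<bar>average g x - g x\<bar> \<le> ennreal D"
proof -
  \<comment> \<open>Jensen for the absolute value, whose convexity is that of the distance to
    \<open>0\<close>.\<close>
  have "ennreal \<bar>average g x - g x\<bar> \<le> (\<integral>\<^sup>+ u. K x u * \<bar>g u - g x\<bar> \<partial>lborel)"
    unfolding average_diff[OF g]
    by (rule average_jensen[OF local_L1_diff_const[OF g]])
       (use convex_on_dist[OF convex_UNIV, of "0 :: real"] in simp_all)
  also have "\<dots> \<le> (\<integral>\<^sup>+ u. K x u * D \<partial>lborel)"
  proof (intro nn_integral_mono ennreal_leI)
    show "K x u * \<bar>g u - g x\<bar> \<le> K x u * D" for u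
      using D[of u] K_support[of u x] K_nonneg[of x u]
      by (cases "norm (u - x) \<le> r") (auto intro!: mult_left_mono)
  qed
  also have "\<dots> = (\<integral>\<^sup>+ u. ennreal (K x u) \<partial>lborel) * ennreal D"
    by (subst nn_integral_multc[symmetric]) (simp_all add: ennreal_mult' K_nonneg)
  also have "\<dots> = ennreal D"
    by (simp add: nn_integral_K_right)
  finally show ?thesis .
qed

context
  fixes q :: "real \<Rightarrow> real" and g :: "'a \<Rightarrow> real"
  assumes convex_q: "convex_on UNIV q"
    and measurable_q [measurable]: "q \<in> borel_measurable borel"
    and q_nonneg: "\<And>y. 0 \<le> q y"
    and g: "local_L1 g"
begin

private lemma [measurable]: "g \<in> borel_measurable borel"
  using g by (rule measurable_local_L1)

lemma nn_integral_average_le: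
  "(\<integral>\<^sup>+ x. q (average g x) \<partial>lborel) \<le> (\<integral>\<^sup>+ u. q (g u) \<partial>lborel)"
proof -
  have "(\<integral>\<^sup>+ x. q (average g x) \<partial>lborel) \<le> (\<integral>\<^sup>+ x. (\<integral>\<^sup>+ u. K x u * q (g u) \<partial>lborel) \<partial>lborel)"
    by (intro nn_integral_mono average_jensen g convex_q measurable_q q_nonneg)
  also have "\<dots> = (\<integral>\<^sup>+ u. (\<integral>\<^sup>+ x. K x u * q (g u) \<partial>lborel) \<partial>lborel)"
    by (rule lborel_pair.Fubini'[symmetric]) measurable
  also have "\<dots> = (\<integral>\<^sup>+ u. (\<integral>\<^sup>+ x. ennreal (K x u) \<partial>lborel) * ennreal (q (g u)) \<partial>lborel)"
    by (intro nn_integral_cong, subst nn_integral_multc[symmetric]) (simp_all add: ennreal_mult' K_nonneg)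
  finally show ?thesis
    by (simp add: nn_integral_K_left)
qed

text \<open>The hypothesis controls one shift \<open>t\<close> at a time, so the integral over
  \<open>x\<close> has to be taken for fixed \<open>t\<close>. For this the kernel is first replaced
  by a bound that does not depend on \<open>x\<close>.\<close>

lemma nn_integral_average_diff_le:
  assumes D: "\<And>t. norm t \<le> r \<Longrightarrow> (\<integral>\<^sup>+ x. q (g (x + t) - g x) \<partial>lborel) \<le> D"
  shows "(\<integral>\<^sup>+ x. q (average g x - g x) \<partial>lborel) \<le> ennreal B * emeasure lborel (cball (0 :: 'a) r) * D"
proof -
  have [measurable]: "cball (0 :: 'a) r \<in> sets borel"
    by simp
  have "(\<integral>\<^sup>+ x. q (average g x - g x) \<partial>lborel)
      \<le> (\<integral>\<^sup>+ x. (\<integral>\<^sup>+ u. K x u * q (g u - g x) \<partial>lborel) \<partial>lborel)"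
    unfolding average_diff[OF g]
    by (intro nn_integral_mono average_jensen local_L1_diff_const g convex_q measurable_q q_nonneg)
  also have "\<dots> = (\<integral>\<^sup>+ x. (\<integral>\<^sup>+ t. K x (x + t) * q (g (x + t) - g x) \<partial>lborel) \<partial>lborel)"
  proof (rule nn_integral_cong)
    show "(\<integral>\<^sup>+ u. K x u * q (g u - g x) \<partial>lborel)
        = (\<integral>\<^sup>+ t. K x (x + t) * q (g (x + t) - g x) \<partial>lborel)" for x
      by (rule nn_integral_lborel_translate[symmetric]) measurable
  qed
  \<comment> \<open>The weight \<open>B\<close> on the ball of radius \<open>r\<close> depends on
    \<open>t\<close> only and can leave the integral over \<open>x\<close> after Tonelli.\<close>
  also have "\<dots> \<le> (\<integral>\<^sup>+ x. (\<integral>\<^sup>+ t. ennreal B * indicator (cball 0 r) t * ennreal (q (g (x + t) - g x)) \<partial>lborel) \<partial>lborel)"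
  proof (intro nn_integral_mono)
    show "ennreal (K x (x + t) * q (g (x + t) - g x))
        \<le> ennreal B * indicator (cball 0 r) t * ennreal (q (g (x + t) - g x))" for x t
      using K_support[of "x + t" x] K_le[of x "x + t"]
      by (cases "norm t \<le> r")
         (auto simp: ennreal_mult'[symmetric] ennreal_mult[symmetric] B_nonneg q_nonneg intro!: ennreal_leI mult_right_mono)
  qed
  also have "\<dots> = (\<integral>\<^sup>+ t. (\<integral>\<^sup>+ x. ennreal B * indicator (cball 0 r) t * ennreal (q (g (x + t) - g x)) \<partial>lborel) \<partial>lborel)"
  proof (rule lborel_pair.Fubini'[symmetric])
    have "(\<lambda>(x, t). ennreal B * indicator (cball 0 r) t * ennreal (q (g (x + t) - g x)))
        \<in> borel_measurable (borel \<Otimes>\<^sub>M borel)"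
      by measurable
    then show "(\<lambda>(x, t). ennreal B * indicator (cball 0 r) t * ennreal (q (g (x + t) - g x)))
        \<in> borel_measurable (lborel \<Otimes>\<^sub>M lborel)"
      by (simp add: lborel_prod borel_prod)
  qed
  also have "\<dots> = (\<integral>\<^sup>+ t. ennreal B * indicator (cball 0 r) t * (\<integral>\<^sup>+ x. q (g (x + t) - g x) \<partial>lborel) \<partial>lborel)"
    by (intro nn_integral_cong nn_integral_cmult) measurable
  also have "\<dots> \<le> (\<integral>\<^sup>+ t. ennreal B * indicator (cball (0 :: 'a) r) t * D \<partial>lborel)"
  proof (rule nn_integral_mono)
    show "ennreal B * indicator (cball 0 r) t * (\<integral>\<^sup>+ x. q (g (x + t) - g x) \<partial>lborel)
        \<le> ennreal B * indicator (cball 0 r) t * D" for t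
      using D[of t] by (auto simp: indicator_def intro!: mult_left_mono)
  qed
  also have "\<dots> = ennreal B * emeasure lborel (cball (0 :: 'a) r) * D"
    by (simp add: nn_integral_multc nn_integral_cmult)
  finally show ?thesis .
qed

end

end


subsection \<open>Measurability and integration on the coordinate space\<close>

lemma borel_measurable_vec_nth [measurable (raw)]:
  fixes f :: "'a \<Rightarrow> real ^ 'n"
  assumes "f \<in> borel_measurable M"
  shows "(\<lambda>x. f x $ i) \<in> borel_measurable M"
  using assms by (rule borel_measurable_continuous_on[rotated]) (intro continuous_intros)

text \<open>The product formula over \<open>Basis\<close>, reindexed along the injection that sends
  \<open>i\<close> to \<open>axis i 1\<close>.\<close>

lemma nn_integral_lborel_vec_prod:
  fixes f :: "'n::finite \<Rightarrow> real \<Rightarrow> real"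
  assumes [measurable]: "\<And>i. f i \<in> borel_measurable borel"
    and nonneg: "\<And>i y. 0 \<le> f i y"
  shows "(\<integral>\<^sup>+ x. (\<Prod>i\<in>UNIV. f i (x $ i)) \<partial>(lborel :: (real ^ 'n) measure))
      = (\<Prod>i\<in>UNIV. \<integral>\<^sup>+ y. f i y \<partial>lborel)"
proof -
  have Basis: "(Basis :: (real ^ 'n) set) = range (\<lambda>i. axis i 1)"
    by (auto simp: Basis_vec_def)
  have inj: "inj (\<lambda>i::'n. axis i (1 :: real))"
    by (auto simp: inj_def axis_eq_axis)
  have "(\<integral>\<^sup>+ x. (\<Prod>b\<in>Basis. ennreal (f (axis_index b) (x \<bullet> b))) \<partial>(lborel :: (real ^ 'n) measure))
      = (\<Prod>b\<in>(Basis :: (real ^ 'n) set). \<integral>\<^sup>+ y. f (axis_index b) y \<partial>lborel)"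
    by (rule nn_integral_lborel_prod[where f = "\<lambda>b y. ennreal (f (axis_index b) y)"]) auto
  then show ?thesis
    unfolding Basis prod.reindex[OF inj] by (simp add: o_def inner_axis prod_ennreal nonneg)
qed

text \<open>The faces of the sampling boxes lie in such hyperplanes.\<close>

lemma AE_component_neq:
  fixes c :: real
  shows "AE x in lborel. (x :: real ^ 'n) $ i \<noteq> c"
proof -
  have "axis i 1 \<in> (Basis :: (real ^ 'n) set)"
    by simp
  then have "negligible {x :: real ^ 'n. x \<bullet> axis i 1 = c}"
    by (rule negligible_standard_hyperplane)
  then have "{x :: real ^ 'n. x $ i = c} \<in> null_sets lebesgue"
    by (simp add: negligible_iff_null_sets inner_axis)
  then have "AE x in lebesgue. (x :: real ^ 'n) $ i \<noteq> c"
    by (auto dest: AE_not_in)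
  then show ?thesis
    by (simp add: AE_completion_iff)
qed

lemma finite_int_vec:
  assumes "\<And>i. finite (A i)"
  shows "finite {j :: int ^ 'n. \<forall>i. j $ i \<in> A i}"
proof (rule finite_imageD)
  have "vec_nth ` {j :: int ^ 'n. \<forall>i. j $ i \<in> A i} \<subseteq> Pi\<^sub>E UNIV A"
    by auto
  then show "finite (vec_nth ` {j :: int ^ 'n. \<forall>i. j $ i \<in> A i})"
    by (rule finite_subset) (auto intro: finite_PiE assms)
qed (auto simp: inj_on_def vec_eq_iff)

subsection \<open>Borel representatives\<close>

text \<open>The operator and the modular refer to Lebesgue measurable functions, while the averaging
  estimates apply Tonelli and translations to Borel functions. This relation carries results from
  \<open>g\<close> to \<open>f\<close>.\<close>

definition borel_version :: "('a::euclidean_space \<Rightarrow> real) \<Rightarrow> ('a \<Rightarrow> real) \<Rightarrow> bool" where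
  "borel_version f g \<longleftrightarrow>
     f \<in> borel_measurable lebesgue \<and> g \<in> borel_measurable borel \<and> (AE x in lborel. f x = g x)"

lemma borel_version_exists:
  assumes "f \<in> borel_measurable lebesgue"
  obtains g where "borel_version f g"
  using completion_ex_borel_measurable_real[OF assms] assms by (auto simp: borel_version_def)

lemma borel_version_refl:
  "f \<in> borel_measurable borel \<Longrightarrow> borel_version f f"
  by (simp add: borel_version_def measurable_completion)

context
  fixes f g :: "'a::euclidean_space \<Rightarrow> real"
  assumes fg: "borel_version f g"
begin

lemma borel_version_measurable: "g \<in> borel_measurable borel"
  using fg by (simp add: borel_version_def)

lemma borel_version_AE_translate: "AE x in lborel. f (x + t) = g (x + t)"
proof -
  \<comment> \<open>The exceptional set need not be Borel; a Borel null set covering it can be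
    translated inside \<open>lborel\<close>.\<close>
  obtain N where N: "N \<in> null_sets lborel" "{x. f x \<noteq> g x} \<subseteq> N"
    using fg by (auto simp: borel_version_def eventually_ae_filter)
  have "AE x in distr lborel borel ((+) t). x \<notin> N"
    unfolding lborel_distr_plus by (rule AE_not_in[OF N(1)])
  then have "AE x in lborel. t + x \<notin> N"
    by (subst (asm) AE_distr_iff) (use N in auto)
  then show ?thesis
    using N(2) by (auto simp: add.commute)
qed

context
  fixes S :: "'a set"
  assumes S: "S \<in> sets borel"
begin

private lemma measurable_indicator_mult:
  "(\<lambda>x. indicator S x *\<^sub>R f x) \<in> borel_measurable lebesgue"
  "(\<lambda>x. indicator S x *\<^sub>R g x) \<in> borel_measurable lborel"
  "(\<lambda>x. indicator S x *\<^sub>R g x) \<in> borel_measurable lebesgue"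
proof -
  have [measurable]: "f \<in> borel_measurable lebesgue" "g \<in> borel_measurable borel"
      "S \<in> sets borel" "S \<in> sets lebesgue"
    using fg S by (auto simp: borel_version_def)
  show "(\<lambda>x. indicator S x *\<^sub>R f x) \<in> borel_measurable lebesgue"
    by measurable
  show "(\<lambda>x. indicator S x *\<^sub>R g x) \<in> borel_measurable lborel"
    by measurable
  then show "(\<lambda>x. indicator S x *\<^sub>R g x) \<in> borel_measurable lebesgue"
    by (rule measurable_completion)
qed

private lemma AE_indicator: "AE x in lebesgue. indicator S x *\<^sub>R f x = indicator S x *\<^sub>R g x"
  using fg by (auto simp: borel_version_def AE_completion_iff)

lemma borel_version_set_integrable:
  "set_integrable lebesgue S f \<longleftrightarrow> set_integrable lborel S g"
  unfolding set_integrable_def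
  using integrable_cong_AE[OF measurable_indicator_mult(1,3) AE_indicator]
  by (simp only: integrable_completion[OF measurable_indicator_mult(2)])

lemma borel_version_set_integral:
  "(LINT x:S|lebesgue. f x) = (LINT x:S|lborel. g x)"
  unfolding set_lebesgue_integral_def
  using integral_cong_AE[OF measurable_indicator_mult(1,3) AE_indicator]
  by (simp only: integral_completion[OF measurable_indicator_mult(2)])

end

end

subsection \<open>The Kantorovich operator as an averaging operator\<close>

text \<open>The floor vector is the node of the half-open cell that contains \<open>u\<close>.
  Integrating a function against this kernel therefore takes all cell integrals and sums them over
  the nodes at once.\<close>

definition bspline_averaging :: "nat \<Rightarrow> real \<Rightarrow> real ^ 'n \<Rightarrow> real ^ 'n \<Rightarrow> real" where
  "bspline_averaging k w x u =
     w ^ CARD('n) * bspline_kernel k (w *\<^sub>R x - int_node (\<chi> i. \<lfloor>w * u $ i\<rfloor>))"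

lemma bspline_averaging_prod:
  "bspline_averaging k w x u = (\<Prod>i\<in>UNIV. w * central_bspline k (w * x $ i - of_int \<lfloor>w * u $ i\<rfloor>))"
  by (simp add: bspline_averaging_def bspline_kernel_def int_node_def prod.distrib)

text \<open>The half-width \<open>k / 2\<close> of the spline plus \<open>1\<close> for the rounding
  of \<open>w * u\<close>, times the dimension because the norm is bounded by the sum of the
  coordinates. The type argument supplies the dimension.\<close>

definition averaging_radius :: "'n itself \<Rightarrow> nat \<Rightarrow> real" where
  "averaging_radius _ k = real CARD('n) * (real k / 2 + 1)"

lemma floor_mult_diff_bound:
  fixes w :: real
  assumes "w > 0" "\<bar>w * x - of_int \<lfloor>w * u\<rfloor>\<bar> \<le> c"
  shows "\<bar>u - x\<bar> \<le> (c + 1) / w"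
proof -
  have "w * \<bar>u - x\<bar> = \<bar>w * u - w * x\<bar>"
    using assms(1) by (simp add: abs_mult right_diff_distrib[symmetric])
  also have "\<dots> \<le> c + 1"
    using assms(2) floor_correct[of "w * u"] by linarith
  finally show ?thesis
    using assms(1) by (simp add: field_simps)
qed

lemma averaging_kernel_bspline:
  fixes b :: real
  assumes k: "k \<ge> 1" and w: "w > 0" and b: "\<And>y. central_bspline k y \<le> b"
  shows "averaging_kernel (bspline_averaging k w :: real ^ 'n \<Rightarrow> _)
     (averaging_radius TYPE('n) k / w) ((w * b) ^ CARD('n))"
proof
  show "case_prod (bspline_averaging k w :: real ^ 'n \<Rightarrow> _) \<in> borel_measurable (borel \<Otimes>\<^sub>M borel)"
    unfolding bspline_averaging_prod by measurable
  fix x u :: "real ^ 'n"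
  note nonneg = central_bspline_nonneg[OF k]
  show "0 \<le> bspline_averaging k w x u"
    unfolding bspline_averaging_prod by (intro prod_nonneg) (simp add: nonneg w less_imp_le)
  have "bspline_averaging k w x u \<le> (\<Prod>i\<in>(UNIV :: 'n set). w * b)"
    unfolding bspline_averaging_prod by (intro prod_mono) (simp add: nonneg w less_imp_le b)
  then show "bspline_averaging k w x u \<le> (w * b) ^ CARD('n)"
    by simp
  show "(\<integral>\<^sup>+ u. bspline_averaging k w x u \<partial>lborel) = 1"
    unfolding bspline_averaging_prod
    by (subst nn_integral_lborel_vec_prod) (auto simp: nonneg w less_imp_le nn_integral_central_bspline_floor[OF k w])
  show "(\<integral>\<^sup>+ x. bspline_averaging k w x u \<partial>lborel) = 1"
    unfolding bspline_averaging_prod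
    by (subst nn_integral_lborel_vec_prod[where f = "\<lambda>i y. w * central_bspline k (w * y - of_int \<lfloor>w * u $ i\<rfloor>)"])
       (auto simp: nonneg w less_imp_le nn_integral_central_bspline_translate[OF k w])
  assume far: "norm (u - x) > averaging_radius TYPE('n) k / w"
  \<comment> \<open>If every coordinate stayed within \<open>k / 2\<close>, the l1 norm of
    \<open>u - x\<close>, hence its Euclidean norm, would be at most the radius.\<close>
  have "\<exists>i. \<bar>w * x $ i - of_int \<lfloor>w * u $ i\<rfloor>\<bar> > real k / 2"
  proof (rule ccontr)
    assume "\<not> ?thesis"
    then have "\<bar>u $ i - x $ i\<bar> \<le> (real k / 2 + 1) / w" for i
      using floor_mult_diff_bound[OF w] by (meson not_le)
    then have "(\<Sum>i\<in>UNIV. \<bar>(u - x) $ i\<bar>) \<le> (\<Sum>i\<in>(UNIV :: 'n set). (real k / 2 + 1) / w)"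
      by (intro sum_mono) simp
    then show False
      using far norm_le_l1_cart[of "u - x"] by (simp add: averaging_radius_def)
  qed
  then show "bspline_averaging k w x u = 0"
    unfolding bspline_averaging_prod using central_bspline_support[OF k] by fastforce
qed

lemma sample_box_iff_floor:
  assumes w: "w > 0" and "\<And>i. w * u $ i \<notin> \<int>"
  shows "u \<in> sample_box w j \<longleftrightarrow> j = (\<chi> i. \<lfloor>w * u $ i\<rfloor>)"
proof -
  have "(of_int (j $ i) / w \<le> u $ i \<and> u $ i \<le> (of_int (j $ i) + 1) / w) \<longleftrightarrow> j $ i = \<lfloor>w * u $ i\<rfloor>" for i
  proof -
    have "(of_int (j $ i) / w \<le> u $ i \<and> u $ i \<le> (of_int (j $ i) + 1) / w)
        \<longleftrightarrow> of_int (j $ i) \<le> w * u $ i \<and> w * u $ i \<le> of_int (j $ i) + 1"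
      using w by (simp add: field_simps)
    \<comment> \<open>Off the grid the closed right end is never attained, so the closed box acts as
      a half-open cell.\<close>
    also have "\<dots> \<longleftrightarrow> of_int (j $ i) \<le> w * u $ i \<and> w * u $ i < of_int (j $ i) + 1"
      using assms(2)[of i] by (metis Ints_of_int Ints_1 Ints_add less_eq_real_def)
    also have "\<dots> \<longleftrightarrow> j $ i = \<lfloor>w * u $ i\<rfloor>"
      by (auto simp: eq_commute[of "j $ i"] floor_eq_iff)
    finally show ?thesis .
  qed
  then show ?thesis
    by (simp add: sample_box_def mem_box_cart vec_eq_iff)
qed

text \<open>The closed sampling boxes overlap, but only on countably many hyperplanes.\<close>

lemma AE_sample_box_iff_floor:
  assumes "w > 0"
  shows "AE u in lborel. \<forall>j. u \<in> sample_box w j \<longleftrightarrow> j = (\<chi> i. \<lfloor>w * (u :: real ^ 'n) $ i\<rfloor>)"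
proof -
  have "AE u in lborel. \<forall>i. \<forall>m::int. (u :: real ^ 'n) $ i \<noteq> of_int m / w"
    by (simp add: AE_all_countable AE_component_neq)
  then show ?thesis
  proof (eventually_elim, intro allI)
    fix u :: "real ^ 'n" and j
    assume *: "\<forall>i. \<forall>m::int. u $ i \<noteq> of_int m / w"
    have "w * u $ i \<notin> \<int>" for i
      using * assms by (auto elim!: Ints_cases simp: field_simps)
    then show "u \<in> sample_box w j \<longleftrightarrow> j = (\<chi> i. \<lfloor>w * u $ i\<rfloor>)"
      by (rule sample_box_iff_floor[OF assms])
  qed
qed

text \<open>By compact support the series at each point has only finitely many nonzero
  terms.\<close>

lemma finite_bspline_nodes:
  assumes k: "k \<ge> 1"
  shows "finite {j :: int ^ 'n. bspline_kernel k (x - int_node j) \<noteq> 0}"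
proof (rule finite_subset)
  show "{j :: int ^ 'n. bspline_kernel k (x - int_node j) \<noteq> 0}
      \<subseteq> {j. \<forall>i. j $ i \<in> {\<lfloor>x $ i - real k / 2\<rfloor>..\<lceil>x $ i + real k / 2\<rceil>}}"
  proof safe
    fix j :: "int ^ 'n" and i
    assume "bspline_kernel k (x - int_node j) \<noteq> 0"
    then have "central_bspline k (x $ i - of_int (j $ i)) \<noteq> 0"
      by (auto simp: bspline_kernel_def int_node_def)
    then have "\<bar>x $ i - of_int (j $ i)\<bar> \<le> real k / 2"
      using central_bspline_support[OF k] by (meson not_le)
    then have "x $ i - real k / 2 \<le> of_int (j $ i)" "of_int (j $ i) \<le> x $ i + real k / 2"
      by linarith+
    then show "j $ i \<in> {\<lfloor>x $ i - real k / 2\<rfloor>..\<lceil>x $ i + real k / 2\<rceil>}"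
      by (simp add: floor_le_iff le_ceiling_iff)
  qed
qed (rule finite_int_vec, simp)

text \<open>\<open>has_sum\<close> yields convergence and value together: the operator is defined at
  \<open>f\<close>, and it is the average of \<open>g\<close>.\<close>

lemma kantorovich_has_sum:
  fixes f g :: "real ^ 'n \<Rightarrow> real"
  assumes k: "k \<ge> 1" and w: "w > 0" and fg: "borel_version f g"
    and f: "locally_integrable f"
  shows "(kantorovich_term (bspline_kernel k) w f x has_sum
           (LINT u|lborel. bspline_averaging k w x u * g u)) UNIV"
proof -
  define c where "c j = w ^ CARD('n) * bspline_kernel k (w *\<^sub>R x - int_node j)" for j :: "int ^ 'n"
  define J where "J = {j. c j \<noteq> 0}"
  have J: "finite J"
    using finite_bspline_nodes[OF k, of "w *\<^sub>R x"] by (rule finite_subset[rotated]) (auto simp: J_def c_def)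
  have box: "sample_box w j \<in> sets borel" "compact (sample_box w j)" for j :: "int ^ 'n"
    by (simp_all add: sample_box_def compact_cbox)
  note [measurable] = borel_version_measurable[OF fg] box(1)
  have term_eq: "kantorovich_term (bspline_kernel k) w f x j
      = (LINT u|lborel. c j * (indicator (sample_box w j) u *\<^sub>R g u))" for j
    using borel_version_set_integral[OF fg box(1)]
    by (simp add: kantorovich_term_def c_def set_lebesgue_integral_def)
  have int: "integrable lborel (\<lambda>u. c j * (indicator (sample_box w j) u *\<^sub>R g u))" for j
    using borel_version_set_integrable[OF fg box(1)] f box(2)
    by (auto simp: locally_integrable_def set_integrable_def)
  have "(\<Sum>j\<in>J. kantorovich_term (bspline_kernel k) w f x j)
      = (LINT u|lborel. (\<Sum>j\<in>J. c j * (indicator (sample_box w j) u *\<^sub>R g u)))"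
    unfolding term_eq by (rule Bochner_Integration.integral_sum[symmetric]) (rule int)
  also have "\<dots> = (LINT u|lborel. bspline_averaging k w x u * g u)"
  proof (rule integral_cong_AE)
    show "AE u in lborel. (\<Sum>j\<in>J. c j * (indicator (sample_box w j) u *\<^sub>R g u)) = bspline_averaging k w x u * g u"
      using AE_sample_box_iff_floor[OF w]
    proof eventually_elim
      case (elim u)
      have "(\<Sum>j\<in>J. c j * (indicator (sample_box w j) u *\<^sub>R g u))
          = (\<Sum>j\<in>J. if j = (\<chi> i. \<lfloor>w * u $ i\<rfloor>) then c j * g u else 0)"
        using elim by (intro sum.cong) (auto simp: indicator_def)
      \<comment> \<open>If the cell of \<open>u\<close> has its node outside \<open>J\<close>, both
        sides are \<open>0\<close> by the choice of \<open>J\<close>.\<close>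
      also have "\<dots> = c (\<chi> i. \<lfloor>w * u $ i\<rfloor>) * g u"
        using J by (auto simp: sum.delta' J_def)
      finally show ?case
        by (simp add: c_def bspline_averaging_def)
    qed
  qed (unfold bspline_averaging_prod, measurable)
  finally have "(kantorovich_term (bspline_kernel k) w f x has_sum
      (LINT u|lborel. bspline_averaging k w x u * g u)) J"
    using J by (intro has_sum_finiteI) simp_all
  then show ?thesis
    by (rule has_sum_cong_neutral[THEN iffD1, rotated -1]) (auto simp: J_def c_def kantorovich_term_def)
qed


section \<open>Transfer of the averaging estimates to the Kantorovich operator\<close>

context
  fixes f g :: "real ^ 'n \<Rightarrow> real" and k :: nat and w b :: real
  assumes k: "k \<ge> 1" and w: "w > 0" and b: "\<And>y. central_bspline k y \<le> b"
    and fg: "borel_version f g" and f: "locally_integrable f"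
begin

interpretation averaging_kernel "bspline_averaging k w :: real ^ 'n \<Rightarrow> _"
  "averaging_radius TYPE('n) k / w" "(w * b) ^ CARD('n)"
  using k w b by (rule averaging_kernel_bspline)

private lemma local_L1_cmult: "local_L1 (\<lambda>u. l * g u)"
proof -
  have "set_integrable lborel (cball x R) g" for x R
    using f borel_version_set_integrable[OF fg, of "cball x R"] by (simp add: locally_integrable_def)
  then show ?thesis
    using borel_version_measurable[OF fg] by (auto simp: local_L1_def)
qed

private lemma local_L1_g: "local_L1 g"
  using local_L1_cmult[of 1] by simp

lemma kantorovich_defined_bspline: "kantorovich_defined (bspline_kernel k) w f"
  using f kantorovich_has_sum[OF k w fg f] by (auto simp: kantorovich_defined_def summable_on_def)

private lemma kantorovich_eq_average: "kantorovich (bspline_kernel k) w f = average g"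
  using kantorovich_has_sum[OF k w fg f] by (auto simp: kantorovich_def average_def infsumI)

private lemma kantorovich_scaled: "l * kantorovich (bspline_kernel k) w f x = average (\<lambda>u. l * g u) x"
  by (simp add: kantorovich_eq_average average_def mult.left_commute[of _ l])

lemma kantorovich_measurable: "kantorovich (bspline_kernel k) w f \<in> borel_measurable lebesgue"
  unfolding kantorovich_eq_average
  by (rule measurable_completion) (simp add: borel_measurable_average borel_version_measurable[OF fg])

text \<open>The bound involves the value of \<open>f\<close> at the single point \<open>x\<close>,
  so equality almost everywhere would not do; a continuous \<open>f\<close> serves as its own Borel
  version.\<close>

lemma abs_kantorovich_diff_le:
  assumes "f = g"
    and "\<And>u. norm (u - x) \<le> averaging_radius TYPE('n) k / w \<Longrightarrow> \<bar>f u - f x\<bar> \<le> D"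
  shows "ennreal \<bar>kantorovich (bspline_kernel k) w f x - f x\<bar> \<le> ennreal D"
  unfolding kantorovich_eq_average using abs_average_diff_le[OF local_L1_g, of x D] assms by simp

context
  fixes \<phi> :: "real \<Rightarrow> real"
  assumes phi: "convex_on UNIV (\<lambda>y. \<phi> \<bar>y\<bar>)" "(\<lambda>y. \<phi> \<bar>y\<bar>) \<in> borel_measurable borel" "\<And>y. 0 \<le> \<phi> \<bar>y\<bar>"
begin

lemma modular_kantorovich_le:
  "modular \<phi> (\<lambda>x. l * kantorovich (bspline_kernel k) w f x) \<le> modular \<phi> (\<lambda>x. l * f x)"
proof -
  have "modular \<phi> (\<lambda>x. l * kantorovich (bspline_kernel k) w f x)
      = (\<integral>\<^sup>+ x. \<phi> \<bar>average (\<lambda>u. l * g u) x\<bar> \<partial>lborel)"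
    by (simp add: modular_def kantorovich_scaled nn_integral_completion)
  also have "\<dots> \<le> (\<integral>\<^sup>+ u. \<phi> \<bar>l * g u\<bar> \<partial>lborel)"
    using phi local_L1_cmult by (rule nn_integral_average_le)
  also have "\<dots> = modular \<phi> (\<lambda>x. l * f x)"
    unfolding modular_def nn_integral_completion
    by (rule nn_integral_cong_AE) (use fg in \<open>auto simp: borel_version_def\<close>)
  finally show ?thesis .
qed

lemma modular_kantorovich_diff_le:
  assumes D: "\<And>t. norm t \<le> averaging_radius TYPE('n) k / w \<Longrightarrow>
      modular \<phi> (\<lambda>x. l * (f x - f (x + t))) \<le> D"
  shows "modular \<phi> (\<lambda>x. l * (kantorovich (bspline_kernel k) w f x - f x))
    \<le> ennreal ((averaging_radius TYPE('n) k * b) ^ CARD('n) * unit_ball_vol CARD('n)) * D"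
proof -
  have AE_eq: "AE x in lborel. f x = g x"
    using fg by (simp add: borel_version_def)
  have radius: "0 \<le> averaging_radius TYPE('n) k"
    by (simp add: averaging_radius_def)
  have b': "0 \<le> b"
    using central_bspline_nonneg[OF k] b by (rule order_trans)
  have "modular \<phi> (\<lambda>x. l * (kantorovich (bspline_kernel k) w f x - f x))
      = (\<integral>\<^sup>+ x. \<phi> \<bar>average (\<lambda>u. l * g u) x - l * g x\<bar> \<partial>lborel)"
    unfolding modular_def nn_integral_completion
    by (rule nn_integral_cong_AE) (use AE_eq in \<open>auto simp: right_diff_distrib kantorovich_scaled\<close>)
  also have "\<dots> \<le> ennreal ((w * b) ^ CARD('n)) * emeasure lborel (cball (0 :: real ^ 'n) (averaging_radius TYPE('n) k / w)) * D"
  proof (rule nn_integral_average_diff_le[OF phi local_L1_cmult])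
    fix t :: "real ^ 'n"
    assume t: "norm t \<le> averaging_radius TYPE('n) k / w"
    have "(\<integral>\<^sup>+ x. \<phi> \<bar>l * g (x + t) - l * g x\<bar> \<partial>lborel) = modular \<phi> (\<lambda>x. l * (f x - f (x + t)))"
      unfolding modular_def nn_integral_completion
    proof (rule nn_integral_cong_AE)
      show "AE x in lborel. ennreal (\<phi> \<bar>l * g (x + t) - l * g x\<bar>) = ennreal (\<phi> \<bar>l * (f x - f (x + t))\<bar>)"
        using AE_eq borel_version_AE_translate[OF fg, of t]
        by eventually_elim (simp add: right_diff_distrib abs_minus_commute)
    qed
    then show "(\<integral>\<^sup>+ x. \<phi> \<bar>l * g (x + t) - l * g x\<bar> \<partial>lborel) \<le> D"
      using D[OF t] by simp
  qed
  \<comment> \<open>The factor w^n of the kernel bound cancels against the volume of a ball of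
    radius proportional to 1/w, which leaves a constant free of \<open>w\<close>.\<close>
  also have "ennreal ((w * b) ^ CARD('n)) * emeasure lborel (cball (0 :: real ^ 'n) (averaging_radius TYPE('n) k / w))
      = ennreal ((averaging_radius TYPE('n) k * b) ^ CARD('n) * unit_ball_vol CARD('n))"
    using w radius b'
    by (simp add: emeasure_cball ennreal_mult[symmetric] power_mult_distrib power_divide)
  finally show ?thesis .
qed

end

end

subsection \<open>Convex modulars and Lipschitz classes\<close>

text \<open>Convexity of the even extension combines the triangle inequality, monotonicity and
  convexity on the half-line. It puts Jensen's inequality on the whole line within reach.\<close>

lemma convex_phi_abs:
  assumes phi: "phi_function \<phi>" and conv: "convex_on {0..} \<phi>"
  shows "convex_on UNIV (\<lambda>y. \<phi> \<bar>y\<bar>)" "(\<lambda>y. \<phi> \<bar>y\<bar>) \<in> borel_measurable borel" "0 \<le> \<phi> \<bar>y\<bar>"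
proof -
  have mono: "\<phi> x \<le> \<phi> y" if "0 \<le> x" "x \<le> y" for x y
    using phi that by (auto simp: phi_function_def mono_on_def)
  show "convex_on UNIV (\<lambda>y. \<phi> \<bar>y\<bar>)"
  proof (rule convex_onI)
    fix t x y :: real
    assume t: "0 < t" "t < 1"
    have "\<bar>(1 - t) * x + t * y\<bar> \<le> (1 - t) * \<bar>x\<bar> + t * \<bar>y\<bar>"
      using t abs_triangle_ineq[of "(1 - t) * x" "t * y"] by (simp add: abs_mult)
    then have "\<phi> \<bar>(1 - t) * x + t * y\<bar> \<le> \<phi> ((1 - t) * \<bar>x\<bar> + t * \<bar>y\<bar>)"
      by (rule mono[rotated]) simp
    also have "\<dots> \<le> (1 - t) * \<phi> \<bar>x\<bar> + t * \<phi> \<bar>y\<bar>"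
      using convex_onD[OF conv, of t "\<bar>x\<bar>" "\<bar>y\<bar>"] t by simp
    finally show "\<phi> \<bar>(1 - t) *\<^sub>R x + t *\<^sub>R y\<bar> \<le> (1 - t) * \<phi> \<bar>x\<bar> + t * \<phi> \<bar>y\<bar>"
      by simp
  qed simp
  have "continuous_on {0..} \<phi>"
    using phi by (simp add: phi_function_def)
  then have "continuous_on UNIV (\<lambda>y. \<phi> \<bar>y\<bar>)"
    by (rule continuous_on_compose2) (auto intro!: continuous_intros)
  then show "(\<lambda>y. \<phi> \<bar>y\<bar>) \<in> borel_measurable borel"
    by (rule borel_measurable_continuous_onI)
  show "0 \<le> \<phi> \<bar>y\<bar>"
    using mono[of 0 "\<bar>y\<bar>"] phi by (simp add: phi_function_def)
qed

text \<open>A convex \<open>\<phi>\<close> with value \<open>0\<close> at \<open>0\<close> grows at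
  least linearly beyond \<open>1\<close>. Thus \<open>f\<close> is dominated by a constant,
  integrable on compact sets, plus a multiple of the integrand of a finite modular.\<close>

lemma Orlicz_imp_locally_integrable:
  fixes f :: "real ^ 'n \<Rightarrow> real"
  assumes phi: "phi_function \<phi>" and conv: "convex_on {0..} \<phi>" and f: "f \<in> Orlicz \<phi>"
  shows "locally_integrable f"
proof -
  have pos: "\<phi> 1 > 0" and zero: "\<phi> 0 = 0"
    using phi by (auto simp: phi_function_def)
  note phi_abs = convex_phi_abs[OF phi conv]
  have linear: "\<bar>y\<bar> \<le> 1 + \<phi> \<bar>y\<bar> / \<phi> 1" for y
  proof (cases "\<bar>y\<bar> \<le> 1")
    case True
    then show ?thesis using phi_abs(3)[of y] pos by (simp add: add_increasing2)
  next
    case False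
    then have "y \<noteq> 0"
      by auto
    \<comment> \<open>Here \<open>1\<close> is the convex combination of \<open>0\<close> and
      \<open>\<bar>y\<bar>\<close> with weight \<open>1 / \<bar>y\<bar>\<close> on the
      latter.\<close>
    then have "\<phi> 1 \<le> 1 / \<bar>y\<bar> * \<phi> \<bar>y\<bar>"
      using convex_onD[OF conv, of "1 / \<bar>y\<bar>" 0 "\<bar>y\<bar>"] zero False by simp
    then have "\<bar>y\<bar> * \<phi> 1 \<le> \<phi> \<bar>y\<bar>"
      using False by (simp add: field_simps)
    then show ?thesis using pos by (simp add: field_simps)
  qed
  obtain l where l: "l > 0" "modular \<phi> (\<lambda>x. l * f x) < \<infinity>" and [measurable]: "f \<in> borel_measurable lebesgue"
    using f by (auto simp: Orlicz_def)
  note [measurable] = phi_abs(2)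
  show ?thesis
    unfolding locally_integrable_def set_integrable_def
  proof (intro allI impI integrableI_bounded)
    fix S :: "(real ^ 'n) set"
    assume S: "compact S"
    then have [measurable]: "S \<in> sets lebesgue"
      by (simp add: borel_compact)
    show "(\<lambda>x. indicat_real S x *\<^sub>R f x) \<in> borel_measurable lebesgue"
      by measurable
    have bound: "ennreal (norm (indicat_real S x *\<^sub>R f x))
        \<le> ennreal (1 / l) * indicator S x + ennreal (1 / (l * \<phi> 1)) * ennreal (\<phi> \<bar>l * f x\<bar>)" for x
    proof (cases "x \<in> S")
      case True
      have "\<bar>f x\<bar> \<le> 1 / l + 1 / (l * \<phi> 1) * \<phi> \<bar>l * f x\<bar>"
        using linear[of "l * f x"] l(1) pos by (simp add: abs_mult field_simps)
      then show ?thesis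
        using True l(1) pos phi_abs(3)[of "l * f x"]
        by (simp add: ennreal_mult[symmetric] ennreal_plus[symmetric] ennreal_leI del: ennreal_plus)
    qed simp
    have "(\<integral>\<^sup>+ x. ennreal (norm (indicat_real S x *\<^sub>R f x)) \<partial>lebesgue)
        \<le> (\<integral>\<^sup>+ x. ennreal (1 / l) * indicator S x + ennreal (1 / (l * \<phi> 1)) * ennreal (\<phi> \<bar>l * f x\<bar>) \<partial>lebesgue)"
      by (intro nn_integral_mono bound)
    also have "\<dots> = ennreal (1 / l) * emeasure lebesgue S + ennreal (1 / (l * \<phi> 1)) * modular \<phi> (\<lambda>x. l * f x)"
      by (subst nn_integral_add) (auto simp: nn_integral_cmult modular_def)
    also have "\<dots> < \<infinity>"
      using l(2) emeasure_compact_finite[OF S] by (simp add: ennreal_mult_less_top borel_compact[OF S])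
    finally show "(\<integral>\<^sup>+ x. ennreal (norm (indicat_real S x *\<^sub>R f x)) \<partial>lebesgue) < \<infinity>" .
  qed
qed

lemma continuous_imp_locally_integrable:
  fixes f :: "real ^ 'n \<Rightarrow> real"
  assumes f: "continuous_on UNIV f"
  shows "locally_integrable f"
proof -
  have "set_integrable lborel S f" if "compact S" for S
    using borel_integrable_compact[OF that continuous_on_subset[OF f]] by (simp add: set_integrable_def)
  then show ?thesis
    using borel_version_set_integrable[OF borel_version_refl[OF borel_measurable_continuous_onI[OF f]]]
    by (simp add: locally_integrable_def borel_compact)
qed

section \<open>Rates of convergence and the modular inequality\<close>

lemma averaging_radius_pos: "averaging_radius TYPE('n::finite) k > 0"
  by (simp add: averaging_radius_def)

lemma eventually_averaging_radius_le:
  assumes "\<gamma> > 0"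
  shows "\<forall>\<^sub>F w in at_top. w > 0 \<and> averaging_radius TYPE('n::finite) k / w \<le> \<gamma>"
  using eventually_gt_at_top[of 0] eventually_ge_at_top[of "averaging_radius TYPE('n) k / \<gamma>"]
  by eventually_elim (use assms in \<open>auto simp: field_simps\<close>)

text \<open>The source of the rate: only shifts of length at most a constant over \<open>w\<close>
  enter the error.\<close>

lemma powr_radius_bound:
  fixes C \<nu> w :: real
  assumes "C \<ge> 0" "\<nu> > 0" "w > 0" "norm t \<le> averaging_radius TYPE('n::finite) k / w"
  shows "C * norm t powr \<nu> \<le> C * averaging_radius TYPE('n) k powr \<nu> * w powr (- \<nu>)"
proof -
  have "norm t powr \<nu> \<le> (averaging_radius TYPE('n) k / w) powr \<nu>"
    using assms by (intro powr_mono2) auto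
  also have "\<dots> = averaging_radius TYPE('n) k powr \<nu> * w powr (- \<nu>)"
    using assms averaging_radius_pos[where 'n = 'n, of k] by (simp add: powr_divide powr_minus_divide)
  finally show ?thesis
    using assms(1) by (simp add: mult.assoc mult_left_mono)
qed

lemma kantorovich_Lip_infty:
  fixes f :: "real ^ 'n \<Rightarrow> real"
  assumes k: "k \<ge> 1" and \<nu>: "\<nu> > 0" and f: "f \<in> Lip_infty \<nu>"
  shows "w > 0 \<Longrightarrow> kantorovich_defined (bspline_kernel k) w f"
    and "\<exists>C>0. \<forall>\<^sub>F w in at_top.
           sup_norm (\<lambda>x. kantorovich (bspline_kernel k) w f x - f x) \<le> ennreal (C * w powr (- \<nu>))"
proof -
  obtain b where b: "\<And>y. central_bspline k y \<le> b"
    using central_bspline_bounded[OF k] by blast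
  have cont: "continuous_on UNIV f"
    using f by (simp add: Lip_infty_def uniformly_continuous_imp_continuous)
  note version = borel_version_refl[OF borel_measurable_continuous_onI[OF cont]]
  note loc = continuous_imp_locally_integrable[OF cont]
  show "kantorovich_defined (bspline_kernel k) w f" if "w > 0"
    using k that b version loc by (rule kantorovich_defined_bspline)
  obtain C \<gamma> where C: "C > 0" "\<gamma> > 0"
      and Lip: "\<And>t. norm t \<le> \<gamma> \<Longrightarrow> sup_norm (\<lambda>x. f x - f (x + t)) \<le> ennreal (C * norm t powr \<nu>)"
    using f by (auto simp: Lip_infty_def)
  define C' where "C' = C * averaging_radius TYPE('n) k powr \<nu>"
  show "\<exists>C>0. \<forall>\<^sub>F w in at_top.
           sup_norm (\<lambda>x. kantorovich (bspline_kernel k) w f x - f x) \<le> ennreal (C * w powr (- \<nu>))"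
  proof (intro exI[of _ C'] conjI)
    show "C' > 0"
      using C averaging_radius_pos[where 'n = 'n, of k] by (simp add: C'_def)
    show "\<forall>\<^sub>F w in at_top.
        sup_norm (\<lambda>x. kantorovich (bspline_kernel k) w f x - f x) \<le> ennreal (C' * w powr (- \<nu>))"
      using eventually_averaging_radius_le[OF C(2), where 'n = 'n and k = k]
    proof eventually_elim
      case (elim w)
      have "\<bar>f u - f x\<bar> \<le> C' * w powr (- \<nu>)" if "norm (u - x) \<le> averaging_radius TYPE('n) k / w" for u x
      proof -
        \<comment> \<open>The Lipschitz condition is used for the shift \<open>u - x\<close>,
          evaluated at \<open>x\<close>.\<close>
        have "ennreal \<bar>f x - f u\<bar> \<le> sup_norm (\<lambda>y. f y - f (y + (u - x)))"
          unfolding sup_norm_def by (intro SUP_upper2[of x]) simp_all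
        also have "\<dots> \<le> ennreal (C * norm (u - x) powr \<nu>)"
          using that elim by (intro Lip) simp
        finally have "\<bar>f x - f u\<bar> \<le> C * norm (u - x) powr \<nu>"
          using C by (simp add: ennreal_le_iff)
        also have "\<dots> \<le> C' * w powr (- \<nu>)"
          unfolding C'_def using that elim C \<nu> by (intro powr_radius_bound) auto
        finally show ?thesis
          by (simp add: abs_minus_commute)
      qed
      then show ?case
        unfolding sup_norm_def
        by (intro SUP_least abs_kantorovich_diff_le[OF k _ b version loc refl]) (use elim in auto)
    qed
  qed
qed

text \<open>The modular inequality holds at every scale \<open>l\<close>, so a scale with finite
  modular for \<open>f\<close> also works for its image.\<close>

lemma kantorovich_Orlicz:
  fixes f :: "real ^ 'n \<Rightarrow> real"
  assumes k: "k \<ge> 1" and phi: "phi_function \<phi>" and conv: "convex_on {0..} \<phi>" and f: "f \<in> Orlicz \<phi>"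
    and w: "w > 0"
  shows "kantorovich_defined (bspline_kernel k) w f"
    and "modular \<phi> (\<lambda>x. l * kantorovich (bspline_kernel k) w f x) \<le> modular \<phi> (\<lambda>x. l * f x)"
    and "kantorovich (bspline_kernel k) w f \<in> Orlicz \<phi>"
proof -
  obtain b where b: "\<And>y. central_bspline k y \<le> b"
    using central_bspline_bounded[OF k] by blast
  obtain g where g: "borel_version f g"
    using f by (auto simp: Orlicz_def elim: borel_version_exists)
  note loc = Orlicz_imp_locally_integrable[OF phi conv f]
  note setting = k w b g loc
  show "kantorovich_defined (bspline_kernel k) w f"
    by (rule kantorovich_defined_bspline[OF setting])
  show le: "modular \<phi> (\<lambda>x. l * kantorovich (bspline_kernel k) w f x) \<le> modular \<phi> (\<lambda>x. l * f x)" for l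
    by (rule modular_kantorovich_le[OF setting convex_phi_abs[OF phi conv]])
  obtain l where "l > 0" "modular \<phi> (\<lambda>x. l * f x) < \<infinity>"
    using f by (auto simp: Orlicz_def)
  then show "kantorovich (bspline_kernel k) w f \<in> Orlicz \<phi>"
    using le[of l] kantorovich_measurable[OF setting] by (auto simp: Orlicz_def intro: le_less_trans)
qed

lemma kantorovich_Lip_phi:
  fixes f :: "real ^ 'n \<Rightarrow> real"
  assumes k: "k \<ge> 1" and phi: "phi_function \<phi>" and conv: "convex_on {0..} \<phi>"
    and \<nu>: "\<nu> > 0" and f: "f \<in> Orlicz \<phi>" "f \<in> Lip_phi \<phi> \<nu>"
  shows "\<exists>l>0. \<exists>C>0. \<forall>\<^sub>F w in at_top.
      modular \<phi> (\<lambda>x. l * (kantorovich (bspline_kernel k) w f x - f x)) \<le> ennreal (C * w powr (- \<nu>))"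
proof -
  obtain b where b: "b > 0" "\<And>y. central_bspline k y \<le> b"
    using central_bspline_bounded[OF k] by blast
  obtain g where g: "borel_version f g"
    using f by (auto simp: Orlicz_def elim: borel_version_exists)
  note loc = Orlicz_imp_locally_integrable[OF phi conv f(1)]
  obtain l C \<gamma> where C: "l > 0" "C > 0" "\<gamma> > 0"
      and Lip: "\<And>t. norm t \<le> \<gamma> \<Longrightarrow> modular \<phi> (\<lambda>x. l * (f x - f (x + t))) \<le> ennreal (C * norm t powr \<nu>)"
    using f(2) by (auto simp: Lip_phi_def)
  \<comment> \<open>\<open>V\<close> is the kernel bound times the volume of the ball, and
    \<open>C'\<close> turns the Lipschitz bound for shifts into a bound in \<open>w\<close>. The
    scale \<open>l\<close> from the Lipschitz class is kept for the error.\<close>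
  define V where "V = (averaging_radius TYPE('n) k * b) ^ CARD('n) * unit_ball_vol CARD('n)"
  define C' where "C' = C * averaging_radius TYPE('n) k powr \<nu>"
  have pos: "V > 0" "C' > 0"
    using C b averaging_radius_pos[where 'n = 'n, of k] by (simp_all add: V_def C'_def)
  have "\<forall>\<^sub>F w in at_top. modular \<phi> (\<lambda>x. l * (kantorovich (bspline_kernel k) w f x - f x))
      \<le> ennreal (V * C' * w powr (- \<nu>))"
    using eventually_averaging_radius_le[OF C(3), where 'n = 'n and k = k]
  proof eventually_elim
    case (elim w)
    have "modular \<phi> (\<lambda>x. l * (kantorovich (bspline_kernel k) w f x - f x))
        \<le> ennreal V * ennreal (C' * w powr (- \<nu>))"
      unfolding V_def
    proof (rule modular_kantorovich_diff_le[OF k _ b(2) g loc convex_phi_abs[OF phi conv]])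
      fix t :: "real ^ 'n"
      assume t: "norm t \<le> averaging_radius TYPE('n) k / w"
      then have "modular \<phi> (\<lambda>x. l * (f x - f (x + t))) \<le> ennreal (C * norm t powr \<nu>)"
        using elim by (intro Lip) simp
      also have "\<dots> \<le> ennreal (C' * w powr (- \<nu>))"
        unfolding C'_def using t elim C \<nu> by (intro ennreal_leI powr_radius_bound) auto
      finally show "modular \<phi> (\<lambda>x. l * (f x - f (x + t))) \<le> ennreal (C' * w powr (- \<nu>))" .
    qed (use elim in simp)
    also have "\<dots> = ennreal (V * C' * w powr (- \<nu>))"
      using pos by (simp add: ennreal_mult[symmetric] mult.assoc)
    finally show ?case .
  qed
  then show ?thesis
    using C pos by (intro exI[of _ l] exI[of _ "V * C'"] conjI) auto
qed

theorem corollary6p3: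
  fixes k :: nat and \<delta> :: real
  assumes "k \<ge> 1" and "\<delta> = 1"
  shows
    "(\<forall>\<nu> (f :: real ^ 'n \<Rightarrow> real). 0 < \<nu> \<and> \<nu> \<le> 1 \<and> f \<in> Lip_infty \<nu> \<longrightarrow>
        (\<forall>w>0. kantorovich_defined (bspline_kernel k) w f) \<and>
        (\<exists>C>0. \<forall>\<^sub>F w in at_top.
           sup_norm (\<lambda>x. kantorovich (bspline_kernel k) w f x - f x) \<le> ennreal (C * w powr (- \<nu>))))
     \<and>
     (\<forall>\<phi>. phi_function \<phi> \<and> convex_on {0..} \<phi> \<longrightarrow>
        (\<forall>f :: real ^ 'n \<Rightarrow> real. f \<in> Orlicz \<phi> \<longrightarrow>
           (\<forall>w>0. kantorovich_defined (bspline_kernel k) w f) \<and>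
           (\<exists>l>0. modular \<phi> (\<lambda>x. l * f x) < \<infinity> \<and>
              (\<forall>w>0. modular \<phi> (\<lambda>x. l * kantorovich (bspline_kernel k) w f x)
                 \<le> ennreal (1 / \<delta> ^ CARD('n)) * modular \<phi> (\<lambda>x. l * f x))) \<and>
           (\<forall>w>0. kantorovich (bspline_kernel k) w f \<in> Orlicz \<phi>))
        \<and>
        (\<forall>\<nu> (f :: real ^ 'n \<Rightarrow> real). 0 < \<nu> \<and> \<nu> \<le> 1 \<and> f \<in> Orlicz \<phi> \<inter> Lip_phi \<phi> \<nu> \<longrightarrow>
           (\<exists>l>0. \<exists>C>0. \<forall>\<^sub>F w in at_top.
              modular \<phi> (\<lambda>x. l * (kantorovich (bspline_kernel k) w f x - f x))
                \<le> ennreal (C * w powr (- \<nu>)))))"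
proof (intro conjI allI impI; (elim conjE IntE)?)
  fix \<nu> :: real and f :: "real ^ 'n \<Rightarrow> real"
  assume Lip: "0 < \<nu>" "f \<in> Lip_infty \<nu>"
  show "kantorovich_defined (bspline_kernel k) w f" if "0 < w" for w
    using kantorovich_Lip_infty(1)[OF assms(1) Lip that] .
  show "\<exists>C>0. \<forall>\<^sub>F w in at_top.
      sup_norm (\<lambda>x. kantorovich (bspline_kernel k) w f x - f x) \<le> ennreal (C * w powr (- \<nu>))"
    using kantorovich_Lip_infty(2)[OF assms(1) Lip] .
next
  fix \<phi> :: "real \<Rightarrow> real" and f :: "real ^ 'n \<Rightarrow> real"
  assume phi: "phi_function \<phi>" "convex_on {0..} \<phi>" and f: "f \<in> Orlicz \<phi>"
  note bounds = kantorovich_Orlicz[OF assms(1) phi f]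
  show "kantorovich_defined (bspline_kernel k) w f" if "0 < w" for w
    using bounds(1)[OF that] .
  show "kantorovich (bspline_kernel k) w f \<in> Orlicz \<phi>" if "0 < w" for w
    using bounds(3)[OF that] .
  \<comment> \<open>This choice of \<open>l\<close> makes the right side finite, so the inequality
    has content; with \<open>\<delta> = 1\<close> the constant is \<open>1\<close>.\<close>
  obtain l where "l > 0" "modular \<phi> (\<lambda>x. l * f x) < \<infinity>"
    using f by (auto simp: Orlicz_def)
  then show "\<exists>l>0. modular \<phi> (\<lambda>x. l * f x) < \<infinity> \<and>
      (\<forall>w>0. modular \<phi> (\<lambda>x. l * kantorovich (bspline_kernel k) w f x)
         \<le> ennreal (1 / \<delta> ^ CARD('n)) * modular \<phi> (\<lambda>x. l * f x))"
    using bounds(2) assms(2) by auto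
next
  fix \<phi> :: "real \<Rightarrow> real" and \<nu> :: real and f :: "real ^ 'n \<Rightarrow> real"
  assume "phi_function \<phi>" "convex_on {0..} \<phi>" "0 < \<nu>" "f \<in> Orlicz \<phi>" "f \<in> Lip_phi \<phi> \<nu>"
  then show "\<exists>l>0. \<exists>C>0. \<forall>\<^sub>F w in at_top.
      modular \<phi> (\<lambda>x. l * (kantorovich (bspline_kernel k) w f x - f x)) \<le> ennreal (C * w powr (- \<nu>))"
    by (rule kantorovich_Lip_phi[OF assms(1)])
qed

end
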